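(* $(\mathbb{GS},+)$ is a commutative monoid: for all $G,H,J\in\mathbb{GS}$ we have $G+H\in\mathbb{GS}$, $G+H=H+G$, $(G+H)+J=G+(H+J)$, and $G+0=0+G=G$, where $0=\langle\emptyset^0\mid\emptyset^0\rangle$.
   Context: A scoring game is written $G=\langle G^{\mathcal L}\mid G^{\mathcal R}\rangle$, where each of $G^{\mathcal L}$ (the Left options) and $G^{\mathcal R}$ (the Right options) is either a finite nonempty set of scoring games or an atom $\emptyset^{s}$ with $s\in\mathbb R$; game trees are finite. An atom $\emptyset^s$ on a side means that the corresponding player, if to move, has no move and the game ends with score $s$. $G$ is left-atomic if $G^{\mathcal L}$ is an atom, right-atomic if $G^{\mathcal R}$ is an atom. The followers of $G$ are $G$, its options, their options, etc. An atom occurring in $G$ is an atom of $G$ or of any follower of $G$. A game $G$ is guaranteed if for every follower $K$ of $G$: if $K^{\mathcal L}=\emptyset^\ell$ then $\ell\le s$ for every atom $\emptyset^s$ occurring in $K$, and if $K^{\mathcal R}=\emptyset^r$ then $s\le r$ for every atom $\emptyset^s$ occurring in $K$. $\mathbb{GS}$ denotes the class of guaranteed games. The disjunctive sum $G+H$ is defined recursively: its Left options are all $G^L+H$ ($G^L\in G^{\mathcal L}$) and all $G+H^L$ ($H^L\in H^{\mathcal L}$), except that if both $G$ and $H$ are left-atomic with $G^{\mathcal L}=\emptyset^{\ell_1}$, $H^{\mathcal L}=\emptyset^{\ell_2}$, then $(G+H)^{\mathcal L}=\emptyset^{\ell_1+\ell_2}$; Right options are defined symmetrically. *)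

theory Defs
  imports Complex_Main "HOL-Library.FSet" "HOL-Algebra.Group"
begin

text \<open>
  Finite game trees. The datatype also admits the empty set of options on a side, which a scoring
  game must not have; such trees are excluded by the predicate \<open>scoring_game\<close> below. As options
  form sets, HOL equality on this type is the identity of games.
\<close>

datatype game = Game (left: side) (right: side)
  and side = Atom real | Options "game fset"

fun options_of :: "side \<Rightarrow> game fset" where
  "options_of (Atom s) = {||}"
| "options_of (Options A) = A"

lemma size_options_of:
  assumes "x |\<in>| options_of S"
  shows "size x < size S"
proof (cases S)
  case (Options A)
  with assms have "x \<in> fset A" by simp
  then have "size x \<le> (\<Sum>y\<in>fset A. size y)"
    by (intro member_le_sum) auto
  then have "size x < Suc (\<Sum>y\<in>fset A. Suc (size y))"
    by (simp add: sum.distrib less_Suc_eq_le)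
       (meson le_trans le_add1 sum_mono le_SucI order_refl)
  then show ?thesis using Options by (simp add: size_fset_overloaded_simps)
qed (use assms in simp)

lemma size_left_option: "x |\<in>| options_of (left G) \<Longrightarrow> size x < size G"
  by (cases G) (auto dest: size_options_of)

lemma size_right_option: "x |\<in>| options_of (right G) \<Longrightarrow> size x < size G"
  by (cases G) (auto dest: size_options_of)

inductive_set followers :: "game \<Rightarrow> game set" for G :: game where
  self: "G \<in> followers G"
| left_option: "K \<in> followers G \<Longrightarrow> L |\<in>| options_of (left K) \<Longrightarrow> L \<in> followers G"
| right_option: "K \<in> followers G \<Longrightarrow> R |\<in>| options_of (right K) \<Longrightarrow> R \<in> followers G"

definition scoring_game :: "game \<Rightarrow> bool" where
  "scoring_game G \<longleftrightarrow>
     (\<forall>K\<in>followers G. left K \<noteq> Options {||} \<and> right K \<noteq> Options {||})"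

definition atoms :: "game \<Rightarrow> real set" where
  "atoms G = {s. \<exists>K\<in>followers G. left K = Atom s \<or> right K = Atom s}"

definition guaranteed :: "game \<Rightarrow> bool" where
  "guaranteed G \<longleftrightarrow>
     (\<forall>K\<in>followers G.
        (\<forall>l. left K = Atom l \<longrightarrow> (\<forall>s\<in>atoms K. l \<le> s)) \<and>
        (\<forall>r. right K = Atom r \<longrightarrow> (\<forall>s\<in>atoms K. s \<le> r)))"

definition GS :: "game set" where
  "GS = {G. scoring_game G \<and> guaranteed G}"

instantiation game :: "{zero, plus}"
begin

definition zero_game :: game where
  "0 = Game (Atom 0) (Atom 0)"

function plus_game :: "game \<Rightarrow> game \<Rightarrow> game" where
  "plus_game G H =
     Game
       (case (left G, left H) of
          (Atom l1, Atom l2) \<Rightarrow> Atom (l1 + l2)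
        | _ \<Rightarrow> Options ((\<lambda>L. plus_game L H) |`| options_of (left G) |\<union>|
                      (\<lambda>L. plus_game G L) |`| options_of (left H)))
       (case (right G, right H) of
          (Atom r1, Atom r2) \<Rightarrow> Atom (r1 + r2)
        | _ \<Rightarrow> Options ((\<lambda>R. plus_game R H) |`| options_of (right G) |\<union>|
                      (\<lambda>R. plus_game G R) |`| options_of (right H)))"
  by pat_completeness auto
termination
  by (relation "measure (\<lambda>(G, H). size G + size H)")
     (auto dest: size_left_option size_right_option)

declare plus_game.simps [simp del]

instance ..

end

end

theory Submission
  imports Defs
begin

text \<open>The identities hold for all trees, guaranteed or not, by induction on options. A move in
  a sum changes exactly one summand, so both sides of an identity have matching options by the
  induction hypotheses, while atomic sides match because addition on the reals is commutative,
  associative and has unit 0.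

  Closure of \<open>GS\<close> rests on \<open>followers_plus\<close> and \<open>atoms_plus\<close>:
  followers of G + H are sums A + B of followers, and each atom of A + B is a sum of an atom of A
  and an atom of B. If A + B is left-atomic, so are A and B, and the guaranteed inequalities for A
  and B add up; likewise on the right.\<close>

lemma game_option_induct [case_names step]:
  assumes "\<And>G. (\<And>L. L |\<in>| options_of (left G) \<Longrightarrow> P L) \<Longrightarrow>
               (\<And>R. R |\<in>| options_of (right G) \<Longrightarrow> P R) \<Longrightarrow> P G"
  shows "P G"
proof (induction G rule: measure_induct_rule[of size])
  case (less G)
  show ?case
    by (rule assms; rule less.IH; erule size_left_option size_right_option)
qed

text \<open>\<open>options_of\<close> sends every atom, as well as \<open>Options {||}\<close>, to
  the empty set, so the score has to be compared separately. This splits equality of games into a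
  set equation and a real equation.\<close>

lemma side_eqI:
  assumes "options_of S = options_of T" and "\<And>s. S = Atom s \<longleftrightarrow> T = Atom s"
  shows "S = T"
  using assms by (metis options_of.elims)

lemma game_eqI:
  assumes "options_of (left G) = options_of (left H)"
    and "\<And>s. left G = Atom s \<longleftrightarrow> left H = Atom s"
    and "options_of (right G) = options_of (right H)"
    and "\<And>s. right G = Atom s \<longleftrightarrow> right H = Atom s"
  shows "G = H"
  using assms by (intro game.expand conjI side_eqI)

text \<open>No case distinction remains: an atomic side contributes an empty image, and when both
  sides are atoms the union is empty, as it should be.\<close>

lemma left_options_plus:
  "options_of (left (G + H)) =
     (\<lambda>L. L + H) |`| options_of (left G) |\<union>| (\<lambda>L. G + L) |`| options_of (left H)"
  by (subst plus_game.simps) (simp split: side.split)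

lemma right_options_plus:
  "options_of (right (G + H)) =
     (\<lambda>R. R + H) |`| options_of (right G) |\<union>| (\<lambda>R. G + R) |`| options_of (right H)"
  by (subst plus_game.simps) (simp split: side.split)

lemma left_plus_eq_Atom_iff:
  "left (G + H) = Atom s \<longleftrightarrow>
     (\<exists>a b. left G = Atom a \<and> left H = Atom b \<and> s = a + b)"
  by (subst plus_game.simps) (auto split: side.split)

lemma right_plus_eq_Atom_iff:
  "right (G + H) = Atom s \<longleftrightarrow>
     (\<exists>a b. right G = Atom a \<and> right H = Atom b \<and> s = a + b)"
  by (subst plus_game.simps) (auto split: side.split)

lemmas plus_game_sides =
  left_options_plus right_options_plus left_plus_eq_Atom_iff right_plus_eq_Atom_iff

text \<open>If the sum is not left-atomic, some summand is not, and its options already make the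
  union nonempty.\<close>

lemma left_plus_nonempty:
  assumes "left G \<noteq> Options {||}" and "left H \<noteq> Options {||}"
  shows "left (G + H) \<noteq> Options {||}"
  using assms by (subst plus_game.simps) (auto split: side.split)

lemma right_plus_nonempty:
  assumes "right G \<noteq> Options {||}" and "right H \<noteq> Options {||}"
  shows "right (G + H) \<noteq> Options {||}"
  using assms by (subst plus_game.simps) (auto split: side.split)

text \<open>The inductions are nested: the outer hypothesis, for arbitrary H, covers moves in G; the
  inner one, with G fixed, covers moves in H.\<close>

lemma plus_game_commute: "G + H = H + (G :: game)"
proof (induction G arbitrary: H rule: game_option_induct)
  case (step G)
  note G = step
  show ?case
  proof (induction H rule: game_option_induct)
    case (step H)
    have "(\<lambda>L. L + H) |`| options_of (left G) = (\<lambda>L. H + L) |`| options_of (left G)"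
      and "(\<lambda>R. R + H) |`| options_of (right G) = (\<lambda>R. H + R) |`| options_of (right G)"
      by (intro fset.map_cong0; rule G; assumption)+
    moreover have "(\<lambda>L. G + L) |`| options_of (left H) = (\<lambda>L. L + G) |`| options_of (left H)"
      and "(\<lambda>R. G + R) |`| options_of (right H) = (\<lambda>R. R + G) |`| options_of (right H)"
      by (intro fset.map_cong0; rule step; assumption)+
    \<comment> \<open>Once the summands are swapped inside the images, the two option sets differ
      only in the order of the union.\<close>
    ultimately show ?case
      by (intro game_eqI) (simp_all only: plus_game_sides funion_commute, auto)
  qed
qed

text \<open>Three nested inductions, one for each summand in which the move may be made.\<close>

lemma plus_game_assoc: "(G + H) + J = G + (H + (J :: game))"
proof (induction G arbitrary: H J rule: game_option_induct)
  case (step G)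
  note G = step
  show ?case
  proof (induction H arbitrary: J rule: game_option_induct)
    case (step H)
    note H = step
    show ?case
    proof (induction J rule: game_option_induct)
      case (step J)
      show ?case
        by (rule game_eqI)
           (auto simp: plus_game_sides G H step add.assoc fimage_funion comp_def
              funion_assoc cong: fimage_cong)
    qed
  qed
qed

lemma plus_game_zero: "G + 0 = (G :: game)"
proof (induction G rule: game_option_induct)
  case (step G)
  have "left 0 = Atom 0" "right 0 = Atom 0"
    by (simp_all add: zero_game_def)
  then show ?case
    by (intro game_eqI) (simp_all add: plus_game_sides step cong: fimage_cong)
qed

lemma zero_plus_game: "0 + G = (G :: game)"
  by (subst plus_game_commute) (rule plus_game_zero)

text \<open>Induction along the moves: an option of A + B replaces either A or B by one of its own
  options.\<close>

lemma followers_plus: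
  assumes "K \<in> followers (G + H)"
  obtains A B where "A \<in> followers G" "B \<in> followers H" "K = A + B"
proof -
  from assms have "\<exists>A\<in>followers G. \<exists>B\<in>followers H. K = A + B"
    by induction
       (fastforce simp: left_options_plus right_options_plus intro: followers.intros)+
  with that show thesis by blast
qed

text \<open>An atom of the sum sits at some A + B where A and B are atomic on the same side. The
  converse fails, since atoms from opposite sides need not combine.\<close>

lemma atoms_plus:
  assumes "s \<in> atoms (G + H)"
  obtains a b where "a \<in> atoms G" "b \<in> atoms H" "s = a + b"
proof -
  from assms obtain K where "K \<in> followers (G + H)" and K: "left K = Atom s \<or> right K = Atom s"
    by (auto simp: atoms_def)
  then obtain A B where AB: "A \<in> followers G" "B \<in> followers H" and "K = A + B"
    by (blast elim: followers_plus)
  with K have "\<exists>a b. (left A = Atom a \<and> left B = Atom b \<or> right A = Atom a \<and> right B = Atom b) \<and> s = a + b"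
    by (auto simp: left_plus_eq_Atom_iff right_plus_eq_Atom_iff)
  with AB that show thesis
    unfolding atoms_def by blast
qed

lemma scoring_game_plus:
  assumes "scoring_game G" and "scoring_game H"
  shows "scoring_game (G + H)"
  unfolding scoring_game_def
proof
  fix K assume "K \<in> followers (G + H)"
  then obtain A B where "A \<in> followers G" "B \<in> followers H" "K = A + B"
    by (rule followers_plus)
  with assms show "left K \<noteq> Options {||} \<and> right K \<noteq> Options {||}"
    by (simp add: scoring_game_def left_plus_nonempty right_plus_nonempty)
qed

lemma guaranteed_plus:
  assumes "guaranteed G" and "guaranteed H"
  shows "guaranteed (G + H)"
  unfolding guaranteed_def
proof (intro ballI conjI allI impI)
  fix K l s assume "K \<in> followers (G + H)" and l: "left K = Atom l" and s: "s \<in> atoms K"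
  then obtain A B where AB: "A \<in> followers G" "B \<in> followers H" and K: "K = A + B"
    by (blast elim: followers_plus)
  obtain a b where "a \<in> atoms A" "b \<in> atoms B" "s = a + b"
    using s K by (blast elim: atoms_plus)
  \<comment> \<open>A and B are guaranteed at their own left atoms, so l1 \<le> a and l2 \<le>
    b.\<close>
  moreover obtain l1 l2 where "left A = Atom l1" "left B = Atom l2" "l = l1 + l2"
    using l K by (auto simp: left_plus_eq_Atom_iff)
  ultimately show "l \<le> s"
    using assms AB by (simp add: guaranteed_def add_mono)
next
  fix K r s assume "K \<in> followers (G + H)" and r: "right K = Atom r" and s: "s \<in> atoms K"
  then obtain A B where AB: "A \<in> followers G" "B \<in> followers H" and K: "K = A + B"
    by (blast elim: followers_plus)
  obtain a b where "a \<in> atoms A" "b \<in> atoms B" "s = a + b"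
    using s K by (blast elim: atoms_plus)
  moreover obtain r1 r2 where "right A = Atom r1" "right B = Atom r2" "r = r1 + r2"
    using r K by (auto simp: right_plus_eq_Atom_iff)
  ultimately show "s \<le> r"
    using assms AB by (simp add: guaranteed_def add_mono)
qed

lemma GS_plus: "G \<in> GS \<Longrightarrow> H \<in> GS \<Longrightarrow> G + H \<in> GS"
  by (simp add: GS_def scoring_game_plus guaranteed_plus)

lemma followers_zero: "followers 0 = {0}"
proof -
  have "K = 0" if "K \<in> followers 0" for K
    using that by induction (auto simp: zero_game_def)
  then show ?thesis by (auto intro: followers.self)
qed

lemma GS_zero: "0 \<in> GS"
  by (auto simp: GS_def scoring_game_def guaranteed_def atoms_def followers_zero)
     (auto simp: zero_game_def)

theorem theorem6:
  "comm_monoid \<lparr>carrier = GS, monoid.mult = (+), one = 0\<rparr> \<and>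
   (\<forall>G\<in>GS. \<forall>H\<in>GS. \<forall>J\<in>GS.
      G + H \<in> GS \<and>
      G + H = H + G \<and>
      (G + H) + J = G + (H + J) \<and>
      G + 0 = G \<and> 0 + G = G)"
proof (intro conjI ballI)
  show "comm_monoid \<lparr>carrier = GS, monoid.mult = (+), one = 0\<rparr>"
    by (rule comm_monoidI)
       (simp_all add: GS_plus GS_zero plus_game_assoc zero_plus_game, rule plus_game_commute)
qed (simp_all add: GS_plus plus_game_assoc plus_game_zero zero_plus_game, rule plus_game_commute)

end
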